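(* Fix one of the two greedy algorithms (forward or reverse) for the actuator placement problem, and for each $\epsilon>0$ let $S_\epsilon\subset V$ be the actuator set it returns for the metric $F_\epsilon$. Suppose that $W_T(S_\epsilon)$ is invertible for every $\epsilon>0$. Then for every approximation factor $\xi>0$ and every initial value $\epsilon_0>0$, the $\epsilon$-selection procedure terminates and returns a pair $(\epsilon,S_\epsilon)$ satisfying $$F(S_\epsilon)<(1+\xi)\,F_\epsilon(S_\epsilon).$$
   Context: Let $A\in\mathbb{R}^{n\times n}$ ($n\ge1$), $T>0$, $V=\{v_1,\dots,v_n\}$. The directed graph $G=(V,E)$ of $A$ has an edge $(v_j,v_i)\in E$ exactly when $A_{ij}\ne0$; $G$ is assumed strongly connected. For $S\subset V$, $B(S)\in\mathbb{R}^{n\times n}$ is the diagonal matrix with $i$th diagonal entry $1$ if $v_i\in S$ and $0$ otherwise, and $W_T(S)=\int_0^T e^{A\tau}B(S)B(S)^\top e^{A^\top\tau}d\tau$. Put $F(S)=\mathrm{tr}(W_T(S)^{-1})$ when $W_T(S)$ is invertible, and $F_\epsilon(S)=\mathrm{tr}((W_T(S)+\epsilon I)^{-1})$ for $\epsilon>0$. Let $\lambda_1(S)$ denote the smallest eigenvalue of $W_T(S)$. $(\hat A,\hat B)$ is controllable if $[\hat B\ \hat A\hat B\cdots\hat A^{n-1}\hat B]$ has rank $n$; $(A,B(S))$ is structurally controllable if there is a controllable pair of real $n\times n$ matrices $(\hat A,\hat B)$ such that $[\hat A\ \hat B]$ and $[A\ B(S)]$ have zeros at exactly the same entries. Let $K\in\mathbb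 N$, $\mathcal C_K=\{S\subset V:|S|=K,\ (A,B(S))\text{ structurally controllable}\}$, assumed nonempty, $\tilde{\mathcal C}_K$ the family of all subsets of members of $\mathcal C_K$, and $\tilde{\mathcal R}_K$ the family of all subsets of the complements $V\setminus S$, $S\in\mathcal C_K$. Let $N=n-K$. Forward greedy for $F_\epsilon$: start with $S=U=\emptyset$; while $U\neq V$ and $|S|<K$, choose $i\in V\setminus U$ minimizing $F_\epsilon(S\cup\{i\})$, add $i$ to $U$, and also add $i$ to $S$ if $S\cup\{i\}\in\tilde{\mathcal C}_K$; return $S_\epsilon=S$. Reverse greedy for $F_\epsilon$: start with $R=U=\emptyset$; while $U\ne V$ and $|R|<N$, choose $j\in V\setminus U$ minimizing $F_\epsilon(V\setminus(R\cup\{j\}))$, add $j$ to $U$, and also add $j$ to $R$ if $R\cup\{j\}\in\tilde{\mathcal R}_K$; return $S_\epsilon=V\setminus R$. In both, ties are broken by a fixed rule so that $S_\epsilon$ is a function of $\epsilon$. $\epsilon$-selection procedure with input $(\xi,\epsilon_0)$: set $i=0$; while $\epsilon_i\ge\xi\lambda_1(S_{\epsilon_i})$, set $\epsilon_{i+1}=\frac12\xi\lambda_1(S_{\epsilon_i})$ and increase $i$ by one; upon exit return $\epsilon=\epsilon_i$ and $S_\epsilon$. *)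

theory Defs
  imports
    "HOL-Analysis.Analysis"
    "HOL-Library.While_Combinator"
    "Graph_Theory.Digraph_Component"
begin

text \<open>
  The nodes of the system are the elements of the finite index type \<open>'n\<close>, so that
  \<open>V = UNIV\<close> and \<open>n = CARD('n)\<close>.
\<close>

text \<open>
  The library operations \<open>*\<close> and \<open>^\<close> on \<open>real^'n^'n\<close> act entrywise,
  so powers and the exponential with respect to \<open>**\<close> are introduced here.
\<close>

definition mat_pow :: "real^'n^'n \<Rightarrow> nat \<Rightarrow> real^'n^'n" where
  "mat_pow A k = ((**) A ^^ k) (mat 1)"

definition mat_exp :: "real^'n^'n \<Rightarrow> real^'n^'n" where
  "mat_exp A = (\<Sum>k. (1 / fact k) *\<^sub>R mat_pow A k)"

definition graph_of :: "real^'n^'n \<Rightarrow> ('n, 'n \<times> 'n) pre_digraph" where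
  "graph_of A = with_proj \<lparr>pverts = UNIV, parcs = {(j, i). A $ i $ j \<noteq> 0}\<rparr>"

definition input_mat :: "'n set \<Rightarrow> real^'n^'n" where
  "input_mat S = (\<chi> i j. if i = j \<and> i \<in> S then 1 else 0)"

definition gramian :: "real^'n^'n \<Rightarrow> real \<Rightarrow> 'n set \<Rightarrow> real^'n^'n" where
  "gramian A T S = integral {0..T} (\<lambda>\<tau>.
     mat_exp (\<tau> *\<^sub>R A) ** input_mat S ** transpose (input_mat S) ** mat_exp (\<tau> *\<^sub>R transpose A))"

text \<open>The value of \<open>F_metric\<close> is meaningful only when the Gramian is invertible.\<close>

definition F_metric :: "real^'n^'n \<Rightarrow> real \<Rightarrow> 'n set \<Rightarrow> real" where
  "F_metric A T S = trace (matrix_inv (gramian A T S))"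

definition F_eps :: "real^'n^'n \<Rightarrow> real \<Rightarrow> real \<Rightarrow> 'n set \<Rightarrow> real" where
  "F_eps A T \<epsilon> S = trace (matrix_inv (gramian A T S + \<epsilon> *\<^sub>R mat 1))"

definition eigenvalues :: "real^'n^'n \<Rightarrow> real set" where
  "eigenvalues M = {l. \<exists>x. x \<noteq> 0 \<and> M *v x = l *\<^sub>R x}"

definition lambda1 :: "real^'n^'n \<Rightarrow> real \<Rightarrow> 'n set \<Rightarrow> real" where
  "lambda1 A T S = Min (eigenvalues (gramian A T S))"

text \<open>
  The rank of the block matrix \<open>[B, A B, \<dots>, A^(n-1) B]\<close> is expressed as its column
  rank (cf. \<open>column_rank_def\<close>), the columns being those of the blocks.
\<close>

definition controllable :: "real^'n^'n \<Rightarrow> real^'n^'n \<Rightarrow> bool" where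
  "controllable A B \<longleftrightarrow>
     dim (\<Union>k<CARD('n). columns (mat_pow A k ** B)) = CARD('n)"

definition same_zeros :: "real^'n^'n \<Rightarrow> real^'n^'n \<Rightarrow> bool" where
  "same_zeros M M' \<longleftrightarrow> (\<forall>i j. M $ i $ j = 0 \<longleftrightarrow> M' $ i $ j = 0)"

definition structurally_controllable :: "real^'n^'n \<Rightarrow> real^'n^'n \<Rightarrow> bool" where
  "structurally_controllable A B \<longleftrightarrow>
     (\<exists>A' B'. controllable A' B' \<and> same_zeros A' A \<and> same_zeros B' B)"

definition C_sets :: "real^'n^'n \<Rightarrow> nat \<Rightarrow> 'n set set" where
  "C_sets A K = {S. card S = K \<and> structurally_controllable A (input_mat S)}"

definition C_tilde :: "real^'n^'n \<Rightarrow> nat \<Rightarrow> 'n set set" where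
  "C_tilde A K = {S. \<exists>S' \<in> C_sets A K. S \<subseteq> S'}"

definition R_tilde :: "real^'n^'n \<Rightarrow> nat \<Rightarrow> 'n set set" where
  "R_tilde A K = {R. \<exists>S' \<in> C_sets A K. R \<subseteq> - S'}"

text \<open>
  A tie-breaking rule selects an element of the set \<open>M\<close> of minimizers; the selection
  may depend on the current sets \<open>S\<close> and \<open>U\<close> of the greedy loop.
\<close>

definition tie_rule :: "('n set \<Rightarrow> 'n set \<Rightarrow> 'n set \<Rightarrow> 'n) \<Rightarrow> bool" where
  "tie_rule tie \<longleftrightarrow> (\<forall>S U M. M \<noteq> {} \<longrightarrow> tie S U M \<in> M)"

text \<open>
  The loop common to both algorithms: \<open>f\<close> is minimized over one-element extensions,
  \<open>I\<close> is the family of admissible sets and \<open>m\<close> the target cardinality.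
\<close>

definition greedy_cond :: "nat \<Rightarrow> 'n::finite set \<times> 'n set \<Rightarrow> bool" where
  "greedy_cond m = (\<lambda>(S, U). U \<noteq> UNIV \<and> card S < m)"

definition greedy_step ::
  "('n set \<Rightarrow> 'n set \<Rightarrow> 'n set \<Rightarrow> 'n) \<Rightarrow> ('n set \<Rightarrow> real) \<Rightarrow> 'n set set
     \<Rightarrow> 'n::finite set \<times> 'n set \<Rightarrow> 'n set \<times> 'n set" where
  "greedy_step tie f I = (\<lambda>(S, U).
     let i = tie S U {i. is_arg_min (\<lambda>i. f (insert i S)) (\<lambda>i. i \<notin> U) i}
     in (if insert i S \<in> I then insert i S else S, insert i U))"

definition greedy ::
  "('n set \<Rightarrow> 'n set \<Rightarrow> 'n set \<Rightarrow> 'n) \<Rightarrow> ('n set \<Rightarrow> real) \<Rightarrow> 'n set set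
     \<Rightarrow> nat \<Rightarrow> 'n::finite set" where
  "greedy tie f I m = fst (while (greedy_cond m) (greedy_step tie f I) ({}, {}))"

lemma greedy_terminates:
  assumes "tie_rule tie"
  shows "\<exists>s. while_option (greedy_cond m) (greedy_step tie f I) ({}, {}) = Some s"
proof (rule measure_while_option_Some[where P = "\<lambda>_. True" and f = "\<lambda>(S, U). card (- U)",
      THEN exE])
  fix s :: "'a set \<times> 'a set"
  assume c: "greedy_cond m s"
  obtain S U where s: "s = (S, U)" by force
  let ?M = "{i. is_arg_min (\<lambda>i. f (insert i S)) (\<lambda>i. i \<notin> U) i}"
  have "\<exists>x. is_arg_min (\<lambda>i. f (insert i S)) (\<lambda>i. i \<in> - U) x"
    using c ex_is_arg_min_if_finite[of "- U" "\<lambda>i. f (insert i S)"]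
    by (auto simp: s greedy_cond_def)
  then have "?M \<noteq> {}" by simp
  then have "tie S U ?M \<in> ?M"
    using assms unfolding tie_rule_def by blast
  then have "tie S U ?M \<notin> U"
    by (simp add: is_arg_min_def)
  then have "- insert (tie S U ?M) U \<subset> - U" by blast
  then have "card (- insert (tie S U ?M) U) < card (- U)"
    by (intro psubset_card_mono) auto
  then show "True \<and> (case greedy_step tie f I s of (S, U) \<Rightarrow> card (- U))
      < (case s of (S, U) \<Rightarrow> card (- U))"
    by (simp add: s greedy_step_def Let_def)
qed auto

definition forward_greedy ::
  "real^'n^'n \<Rightarrow> real \<Rightarrow> nat \<Rightarrow> ('n set \<Rightarrow> 'n set \<Rightarrow> 'n set \<Rightarrow> 'n) \<Rightarrow> real \<Rightarrow> 'n set" where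
  "forward_greedy A T K tie \<epsilon> = greedy tie (F_eps A T \<epsilon>) (C_tilde A K) K"

definition reverse_greedy ::
  "real^'n^'n \<Rightarrow> real \<Rightarrow> nat \<Rightarrow> ('n set \<Rightarrow> 'n set \<Rightarrow> 'n set \<Rightarrow> 'n) \<Rightarrow> real \<Rightarrow> 'n set" where
  "reverse_greedy A T K tie \<epsilon> =
     - greedy tie (\<lambda>R. F_eps A T \<epsilon> (- R)) (R_tilde A K) (CARD('n) - K)"

text \<open>The result \<open>None\<close> means that the procedure does not terminate.\<close>

definition eps_selection ::
  "real^'n^'n \<Rightarrow> real \<Rightarrow> (real \<Rightarrow> 'n set) \<Rightarrow> real \<Rightarrow> real \<Rightarrow> (real \<times> 'n set) option" where
  "eps_selection A T S \<xi> \<epsilon>0 = map_option (\<lambda>\<epsilon>. (\<epsilon>, S \<epsilon>))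
     (while_option (\<lambda>\<epsilon>. \<epsilon> \<ge> \<xi> * lambda1 A T (S \<epsilon>)) (\<lambda>\<epsilon>. 1/2 * \<xi> * lambda1 A T (S \<epsilon>)) \<epsilon>0)"

end

theory Submission
  imports Defs
begin

text \<open>
  The stopping test \<open>\<epsilon> < \<xi> \<lambda>\<^sub>1(S\<^sub>\<epsilon>)\<close> is exactly what makes the regularization
  harmless. With \<open>W\<close> the Gramian of \<open>S\<^sub>\<epsilon>\<close>, the Rayleigh bound
  \<open>\<lambda>\<^sub>1 \<bar>x\<bar>\<^sup>2 \<le> x \<bullet> W x\<close> turns the test into the strict inequality of quadratic forms
  \<open>W + \<epsilon> I < (1 + \<xi>) W\<close>. Inversion reverses it (\<open>inverse_antimono_quadratic_form\<close>),
  so each diagonal entry of \<open>W\<^sup>-\<^sup>1\<close> is smaller than \<open>1 + \<xi>\<close> times that of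
  \<open>(W + \<epsilon> I)\<^sup>-\<^sup>1\<close>; summing over the diagonal compares the traces
  (\<open>trace_inverse_regularized\<close>).

  The loop terminates because \<open>S\<^sub>\<epsilon>\<close>, \<open>\<epsilon> > 0\<close>, takes only finitely many values, each with
  an invertible positive semidefinite Gramian, so \<open>\<lambda>\<^sub>1(S\<^sub>\<epsilon>)\<close> is bounded below by some
  \<open>c > 0\<close> uniformly in \<open>\<epsilon>\<close>. The test succeeds once \<open>\<epsilon> < \<xi> c\<close>, and every pass through the loop at least halves \<open>\<epsilon>\<close>
  (\<open>halving_loop_terminates\<close>).

  No diagonalization enters: the only spectral input is that the minimum of the
  Rayleigh quotient of a symmetric matrix on the unit sphere is an eigenvalue.
\<close>

section \<open>Symmetric matrices and their smallest eigenvalue\<close>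

lemma inner_symmetric_matrix:
  fixes M :: "real^'n^'n"
  assumes "transpose M = M"
  shows "x \<bullet> (M *v y) = (M *v x) \<bullet> y"
  by (metis assms dot_lmul_matrix transpose_matrix_vector)

text \<open>
  If \<open>M x\<close> did not vanish, a small step from \<open>x\<close> in the direction \<open>- M x\<close> would make the
  quadratic form negative.
\<close>

lemma semidefinite_form_zero_imp_kernel:
  fixes M :: "real^'n^'n"
  assumes sym: "transpose M = M"
    and psd: "\<And>y. 0 \<le> y \<bullet> (M *v y)"
    and zero: "x \<bullet> (M *v x) = 0"
  shows "M *v x = 0"
proof (rule ccontr)
  assume "M *v x \<noteq> 0"
  define v where "v = M *v x"
  define s where "s = v \<bullet> v"
  define c where "c = v \<bullet> (M *v v)"
  define t where "t = - s / (c + 1)"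
  have s: "s > 0" using \<open>M *v x \<noteq> 0\<close> by (simp add: s_def v_def)
  have c: "c \<ge> 0" unfolding c_def by (rule psd)
  have xv: "x \<bullet> (M *v v) = s"
    by (simp add: inner_symmetric_matrix[OF sym] s_def v_def)
  have "0 \<le> (x + t *\<^sub>R v) \<bullet> (M *v (x + t *\<^sub>R v))" by (rule psd)
  also have "\<dots> = 2 * t * s + t\<^sup>2 * c"
    using zero xv
    by (simp add: matrix_vector_right_distrib matrix_vector_mult_scaleR inner_add_left
        inner_add_right power2_eq_square flip: v_def c_def s_def)
      (simp add: algebra_simps)
  also have "\<dots> = - (t\<^sup>2 * (c + 2))"
  proof -
    have st: "s = - t * (c + 1)" using c by (simp add: t_def)
    show ?thesis unfolding st by (simp add: algebra_simps power2_eq_square)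
  qed
  also have "\<dots> < 0"
    using s c by (simp add: t_def)
  finally show False by simp
qed

text \<open>
  A minimizer \<open>u\<close> of the form on the unit sphere, with minimum \<open>\<mu>\<close>, is an eigenvector:
  \<open>M - \<mu> I\<close> is positive semidefinite and its form vanishes at \<open>u\<close>.
\<close>

lemma eigenvalue_le_Rayleigh_quotient:
  fixes M :: "real^'n^'n"
  assumes sym: "transpose M = M"
  obtains \<mu> where "\<mu> \<in> eigenvalues M" "\<And>x. \<mu> * (x \<bullet> x) \<le> x \<bullet> (M *v x)"
proof -
  let ?q = "\<lambda>x. x \<bullet> (M *v x)"
  have "axis undefined 1 \<in> sphere (0::real^'n) 1" by simp
  then have "sphere (0::real^'n) 1 \<noteq> {}" by blast
  moreover have "continuous_on (sphere 0 1) ?q"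
    by (intro continuous_intros linear_continuous_on matrix_vector_mul_bounded_linear)
  ultimately obtain u where u: "u \<in> sphere 0 1"
    and min: "\<And>y. y \<in> sphere 0 1 \<Longrightarrow> ?q u \<le> ?q y"
    using continuous_attains_inf[of "sphere 0 1" ?q] by auto
  define \<mu> where "\<mu> = ?q u"
  have bound: "\<mu> * (x \<bullet> x) \<le> ?q x" for x
  proof (cases "x = 0")
    case False
    have "\<mu> \<le> ?q ((1 / norm x) *\<^sub>R x)"
      unfolding \<mu>_def using False by (intro min) simp
    also have "\<dots> = ?q x / (x \<bullet> x)"
      by (simp add: matrix_vector_mult_scaleR power2_norm_eq_inner[symmetric] power2_eq_square)
    finally show ?thesis using False by (simp add: field_simps)
  qed simp
  let ?N = "M - \<mu> *\<^sub>R mat 1"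
  have N: "?N *v y = M *v y - \<mu> *\<^sub>R y" for y
    by (simp add: matrix_vector_mult_diff_rdistrib flip: scaleR_matrix_vector_assoc)
  have "u \<bullet> u = 1" using u by (simp add: norm_eq_1)
  have "?N *v u = 0"
  proof (rule semidefinite_form_zero_imp_kernel)
    show "transpose ?N = ?N"
      using sym by (simp add: transpose_def vec_eq_iff mat_def)
    show "0 \<le> y \<bullet> (?N *v y)" for y
      using bound[of y] by (simp add: N inner_diff_right)
    show "u \<bullet> (?N *v u) = 0"
      using \<open>u \<bullet> u = 1\<close> by (simp add: N inner_diff_right flip: \<mu>_def)
  qed
  then have "M *v u = \<mu> *\<^sub>R u" by (simp add: N)
  moreover have "u \<noteq> 0" using u by auto
  ultimately have "\<mu> \<in> eigenvalues M" unfolding eigenvalues_def by blast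
  with bound that show ?thesis by blast
qed

text \<open>Eigenvectors to distinct eigenvalues are orthogonal, so there is no room for more
  than \<open>n\<close> of them.\<close>

lemma finite_eigenvalues_symmetric:
  fixes M :: "real^'n^'n"
  assumes sym: "transpose M = M"
  shows "finite (eigenvalues M)"
proof -
  have "\<forall>l\<in>eigenvalues M. \<exists>x. x \<noteq> 0 \<and> M *v x = l *\<^sub>R x"
    by (simp add: eigenvalues_def)
  then obtain e where e: "\<And>l. l \<in> eigenvalues M \<Longrightarrow> e l \<noteq> 0 \<and> M *v e l = l *\<^sub>R e l"
    by metis
  have orth: "e k \<bullet> e l = 0" if "k \<in> eigenvalues M" "l \<in> eigenvalues M" "k \<noteq> l" for k l
    using inner_symmetric_matrix[OF sym, of "e k" "e l"] e that by simp
  have "inj_on e (eigenvalues M)"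
    by (rule inj_onI) (metis e orth inner_eq_zero_iff)
  moreover have "finite (e ` eigenvalues M)"
    by (intro pairwise_orthogonal_imp_finite) (auto simp: pairwise_def orthogonal_def intro: orth)
  ultimately show ?thesis by (rule finite_imageD[rotated])
qed

lemma Min_eigenvalue_mem:
  fixes M :: "real^'n^'n"
  assumes "transpose M = M"
  shows "Min (eigenvalues M) \<in> eigenvalues M"
  using assms eigenvalue_le_Rayleigh_quotient finite_eigenvalues_symmetric Min_in
  by (metis empty_iff)

lemma Min_eigenvalue_le_Rayleigh_quotient:
  fixes M :: "real^'n^'n"
  assumes sym: "transpose M = M"
  shows "Min (eigenvalues M) * (x \<bullet> x) \<le> x \<bullet> (M *v x)"
proof -
  obtain \<mu> where "\<mu> \<in> eigenvalues M" and \<mu>: "\<mu> * (x \<bullet> x) \<le> x \<bullet> (M *v x)"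
    using eigenvalue_le_Rayleigh_quotient[OF sym] by metis
  then have "Min (eigenvalues M) \<le> \<mu>"
    by (simp add: finite_eigenvalues_symmetric[OF sym])
  then have "Min (eigenvalues M) * (x \<bullet> x) \<le> \<mu> * (x \<bullet> x)"
    by (intro mult_right_mono) auto
  with \<mu> show ?thesis by simp
qed

lemma Min_eigenvalue_pos:
  fixes M :: "real^'n^'n"
  assumes sym: "transpose M = M"
    and psd: "\<And>x. 0 \<le> x \<bullet> (M *v x)"
    and inv: "invertible M"
  shows "0 < Min (eigenvalues M)"
proof -
  obtain x where x: "x \<noteq> 0" "M *v x = Min (eigenvalues M) *\<^sub>R x"
    using Min_eigenvalue_mem[OF sym] unfolding eigenvalues_def by blast
  have "0 \<le> Min (eigenvalues M) * (x \<bullet> x)"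
    using psd[of x] x by simp
  moreover have "0 < x \<bullet> x" using x(1) by simp
  ultimately have "0 \<le> Min (eigenvalues M)"
    by (simp only: zero_le_mult_iff) linarith
  moreover have "M *v x \<noteq> 0"
    using inj_matrix_vector_mult[OF inv] x(1) by (metis injD matrix_vector_mult_0_right)
  ultimately show ?thesis using x by (cases "Min (eigenvalues M) = 0") auto
qed

section \<open>Traces of inverses\<close>

lemma matrix_inv_right_inverse:
  fixes M :: "real^'n^'n"
  assumes "invertible M"
  shows "M ** matrix_inv M = mat 1"
  using assms unfolding invertible_def matrix_inv_def by (metis (mono_tags, lifting) someI_ex)

lemma positive_definite_imp_invertible:
  fixes M :: "real^'n^'n"
  assumes "\<And>x. x \<noteq> 0 \<Longrightarrow> 0 < x \<bullet> (M *v x)"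
  shows "invertible M"
  unfolding invertible_left_inverse matrix_left_invertible_ker
  by (metis assms inner_zero_right less_irrefl)

text \<open>
  With \<open>M b = x = N a\<close>, where \<open>M\<close> is the smaller form, expanding
  \<open>0 \<le> (b - a) \<bullet> M (b - a)\<close> gives \<open>2 a \<bullet> x \<le> b \<bullet> x + a \<bullet> M a\<close>, and
  \<open>a \<bullet> M a < a \<bullet> N a = a \<bullet> x\<close>.
\<close>

lemma inverse_antimono_quadratic_form:
  fixes M N :: "real^'n^'n"
  assumes symM: "transpose M = M"
    and psd: "\<And>y. 0 \<le> y \<bullet> (M *v y)"
    and less: "\<And>y. y \<noteq> 0 \<Longrightarrow> y \<bullet> (M *v y) < y \<bullet> (N *v y)"
    and invM: "invertible M" and invN: "invertible N"
    and x: "x \<noteq> 0"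
  shows "x \<bullet> (matrix_inv N *v x) < x \<bullet> (matrix_inv M *v x)"
proof -
  define a where "a = matrix_inv N *v x"
  define b where "b = matrix_inv M *v x"
  have a: "N *v a = x" and b: "M *v b = x"
    by (simp_all add: a_def b_def matrix_vector_mul_assoc matrix_inv_right_inverse invM invN)
  have "a \<noteq> 0" using a x by auto
  have "0 \<le> (b - a) \<bullet> (M *v (b - a))" by (rule psd)
  also have "\<dots> = b \<bullet> x - 2 * (a \<bullet> x) + a \<bullet> (M *v a)"
    using inner_symmetric_matrix[OF symM, of b a]
    by (simp add: matrix_vector_mult_diff_distrib b inner_diff_left inner_diff_right
        inner_commute[of x a])
  also have "\<dots> < b \<bullet> x - a \<bullet> x"
    using less[OF \<open>a \<noteq> 0\<close>] a by simp
  finally show ?thesis by (simp add: a_def b_def inner_commute)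
qed

lemma trace_eq_sum_quadratic_form:
  fixes M :: "real^'n^'n"
  shows "trace M = (\<Sum>i\<in>UNIV. axis i 1 \<bullet> (M *v axis i 1))"
  by (simp add: trace_def matrix_vector_mult_basis inner_axis' column_def)

text \<open>
  The forms compared are \<open>W + \<epsilon> I < (1 + \<xi>) W\<close>, strict away from \<open>0\<close> because
  \<open>\<epsilon> \<bar>y\<bar>\<^sup>2 < \<xi> \<lambda>\<^sub>1 \<bar>y\<bar>\<^sup>2 \<le> \<xi> (y \<bullet> W y)\<close>; the factor \<open>1 + \<xi>\<close> comes out when the
  larger form is inverted.
\<close>

lemma trace_inverse_regularized:
  fixes W :: "real^'n^'n"
  assumes sym: "transpose W = W"
    and psd: "\<And>x. 0 \<le> x \<bullet> (W *v x)"
    and inv: "invertible W"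
    and eps: "0 < \<epsilon>" "\<epsilon> < \<xi> * Min (eigenvalues W)" and \<xi>: "0 < \<xi>"
  shows "trace (matrix_inv W) < (1 + \<xi>) * trace (matrix_inv (W + \<epsilon> *\<^sub>R mat 1))"
proof -
  let ?M = "W + \<epsilon> *\<^sub>R mat 1" and ?q = "\<lambda>M x. x \<bullet> (M *v x)"
  have M: "?M *v y = W *v y + \<epsilon> *\<^sub>R y" for y
    by (simp add: matrix_vector_mult_add_rdistrib flip: scaleR_matrix_vector_assoc)
  have symM: "transpose ?M = ?M"
    using sym by (simp add: transpose_def vec_eq_iff mat_def)
  have posM: "0 < ?q ?M y" if "y \<noteq> 0" for y
    using psd[of y] eps(1) that by (simp add: M inner_add_right add_nonneg_pos)
  then have psdM: "0 \<le> ?q ?M y" for y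
    by (cases "y = 0") (auto intro: less_imp_le)
  have invM: "invertible ?M"
    using posM by (rule positive_definite_imp_invertible)
  let ?N = "(1 + \<xi>) *\<^sub>R W"
  have less: "?q ?M y < ?q ?N y" if "y \<noteq> 0" for y
  proof -
    have "\<epsilon> * (y \<bullet> y) < \<xi> * (Min (eigenvalues W) * (y \<bullet> y))"
      using eps that by (simp flip: mult.assoc)
    also have "\<dots> \<le> \<xi> * ?q W y"
      using Min_eigenvalue_le_Rayleigh_quotient[OF sym] \<xi> by (intro mult_left_mono) auto
    finally show ?thesis
      by (simp add: M inner_add_right algebra_simps flip: scaleR_matrix_vector_assoc)
  qed
  have invN: "invertible ?N"
    using inv \<xi> by (intro scalar_invertible) auto
  have "?q (matrix_inv W) x < (1 + \<xi>) * ?q (matrix_inv ?M) x" if "x \<noteq> 0" for x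
  proof -
    (* matrix_inv ((1 + \<xi>) W) = matrix_inv W / (1 + \<xi>), read off by injectivity of W *)
    have "W *v (matrix_inv W *v x - (1 + \<xi>) *\<^sub>R (matrix_inv ?N *v x)) = 0"
      using matrix_inv_right_inverse[OF inv] matrix_inv_right_inverse[OF invN]
      by (simp add: matrix_vector_mult_diff_distrib matrix_vector_mult_scaleR
          matrix_vector_mul_assoc scaleR_matrix_vector_assoc matrix_scalar_ac
          flip: scalar_matrix_assoc)
    then have "matrix_inv W *v x = (1 + \<xi>) *\<^sub>R (matrix_inv ?N *v x)"
      using inj_matrix_vector_mult[OF inv]
      by (metis injD matrix_vector_mult_0_right right_minus_eq)
    then show ?thesis
      using inverse_antimono_quadratic_form[OF symM psdM less invM invN that] \<xi> by simp
  qed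
  then show ?thesis
    unfolding trace_eq_sum_quadratic_form sum_distrib_left
    by (intro sum_strict_mono) auto
qed

section \<open>The controllability Gramian\<close>

lemma bounded_bilinear_matrix_mult:
  "bounded_bilinear ((**) :: real^'n^'m \<Rightarrow> real^'p^'n \<Rightarrow> real^'p^'m)"
  unfolding bilinear_conv_bounded_bilinear[symmetric] bilinear_def
  by (auto intro!: linearI simp: matrix_add_ldistrib matrix_scalar_ac
      simp flip: scalar_matrix_assoc)
    (simp add: matrix_matrix_mult_def vec_eq_iff distrib_right sum.distrib)

lemma bounded_linear_transpose: "bounded_linear (transpose :: real^'n^'m \<Rightarrow> real^'m^'n)"
  by (intro linear_conv_bounded_linear[THEN iffD1] linearI)
    (simp_all add: transpose_def vec_eq_iff)

lemma mat_pow_Suc: "mat_pow A (Suc k) = A ** mat_pow A k"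
  by (simp add: mat_pow_def)

lemma mat_pow_Suc_right: "mat_pow A (Suc k) = mat_pow A k ** A"
proof (induction k)
  case (Suc k)
  then show ?case by (metis mat_pow_Suc matrix_mul_assoc)
qed (simp add: mat_pow_def)

lemma transpose_mat_pow: "transpose (mat_pow A k) = mat_pow (transpose A) k"
proof (induction k)
  case (Suc k)
  then show ?case
    by (metis mat_pow_Suc mat_pow_Suc_right matrix_transpose_mul)
qed (simp add: mat_pow_def)

text \<open>The norm on matrices is only submultiplicative up to a factor \<open>C\<close>, which the
  exponential series absorbs.\<close>

lemma summable_mat_exp:
  fixes A :: "real^'n^'n"
  shows "summable (\<lambda>k. (1 / fact k) *\<^sub>R mat_pow A k)"
proof -
  obtain C where C: "C > 0"
      "\<And>(M :: real^'n^'n) (N :: real^'n^'n). norm (M ** N) \<le> norm M * norm N * C"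
    using bounded_bilinear.pos_bounded[OF bounded_bilinear_matrix_mult] by blast
  define a where "a = C * norm A"
  have pow: "norm (mat_pow A k) \<le> norm (mat 1 :: real^'n^'n) * a ^ k" for k
  proof (induction k)
    case (Suc k)
    have "norm (mat_pow A (Suc k)) \<le> a * norm (mat_pow A k)"
      using C(2)[of A "mat_pow A k"] by (simp add: mat_pow_Suc a_def mult_ac)
    also have "\<dots> \<le> a * (norm (mat 1 :: real^'n^'n) * a ^ k)"
      using Suc C(1) by (intro mult_left_mono) (auto simp: a_def)
    finally show ?case by (simp add: mult_ac)
  qed (simp add: mat_pow_def)
  show ?thesis
  proof (rule summable_comparison_test')
    show "summable (\<lambda>k. norm (mat 1 :: real^'n^'n) * (inverse (fact k) * a ^ k))"
      by (intro summable_mult summable_exp)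
    show "norm ((1 / fact k) *\<^sub>R mat_pow A k)
        \<le> norm (mat 1 :: real^'n^'n) * (inverse (fact k) * a ^ k)" for k
      using pow[of k] by (simp add: field_simps)
  qed
qed

lemma transpose_mat_exp: "transpose (mat_exp A) = mat_exp (transpose A)"
  unfolding mat_exp_def
  by (simp add: bounded_linear.suminf[OF bounded_linear_transpose summable_mat_exp]
      transpose_scalar transpose_mat_pow)

text \<open>
  Transposition and \<open>M \<mapsto> x \<bullet> M x\<close> are linear and so pass under the integral, where the
  integrand satisfies \<open>x \<bullet> N N\<^sup>T x = \<bar>N\<^sup>T x\<bar>\<^sup>2\<close>.
\<close>

lemma integral_gram_matrix:
  fixes N :: "real \<Rightarrow> real^'n^'m"
  assumes int: "(\<lambda>t. N t ** transpose (N t)) integrable_on X"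
  defines "W \<equiv> integral X (\<lambda>t. N t ** transpose (N t))"
  shows "transpose W = W" and "0 \<le> x \<bullet> (W *v x)"
proof -
  show "transpose W = W"
    using integral_linear[OF int bounded_linear_transpose]
    by (simp add: W_def o_def matrix_transpose_mul)
  have lin: "bounded_linear (\<lambda>M :: real^'m^'m. x \<bullet> (M *v x))"
    by (intro linear_conv_bounded_linear[THEN iffD1] linearI)
      (simp_all add: matrix_vector_mult_add_rdistrib inner_add_right
        flip: scaleR_matrix_vector_assoc)
  have "x \<bullet> (W *v x) = integral X (\<lambda>t. x \<bullet> ((N t ** transpose (N t)) *v x))"
    using integral_linear[OF int lin] by (simp add: W_def o_def)
  also have "\<dots> = integral X (\<lambda>t. (x v* N t) \<bullet> (x v* N t))"
    by (simp add: dot_lmul_matrix flip: matrix_vector_mul_assoc)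
  also have "\<dots> \<ge> 0"
  proof (rule integral_nonneg)
    show "(\<lambda>t. (x v* N t) \<bullet> (x v* N t)) integrable_on X"
      using integrable_linear[OF int lin]
      by (simp add: o_def dot_lmul_matrix flip: matrix_vector_mul_assoc)
  qed simp
  finally show "0 \<le> x \<bullet> (W *v x)" .
qed

text \<open>
  A function that is not integrable has integral \<open>0\<close>, which is not invertible; so
  invertibility already supplies the integrability.
\<close>

lemma invertible_gramian_semidefinite:
  fixes A :: "real^'n^'n"
  assumes "invertible (gramian A T S)"
  shows "transpose (gramian A T S) = gramian A T S"
    and "0 \<le> x \<bullet> (gramian A T S *v x)"
proof -
  let ?N = "\<lambda>\<tau>. mat_exp (\<tau> *\<^sub>R A) ** input_mat S"
  have eq: "gramian A T S = integral {0..T} (\<lambda>\<tau>. ?N \<tau> ** transpose (?N \<tau>))"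
    by (simp add: gramian_def matrix_transpose_mul transpose_mat_exp transpose_scalar
        matrix_mul_assoc)
  have "gramian A T S \<noteq> 0"
  proof
    assume "gramian A T S = 0"
    with injD[OF inj_matrix_vector_mult[OF assms], of "axis undefined 1" 0]
    show False by simp
  qed
  then have "(\<lambda>\<tau>. ?N \<tau> ** transpose (?N \<tau>)) integrable_on {0..T}"
    unfolding eq using not_integrable_integral by blast
  from integral_gram_matrix[OF this]
  show "transpose (gramian A T S) = gramian A T S" and "0 \<le> x \<bullet> (gramian A T S *v x)"
    by (simp_all add: eq)
qed

section \<open>The selection loop\<close>

lemma floor_less_of_le_half:
  fixes u w :: real
  assumes "1 \<le> u" "w \<le> u / 2"
  shows "\<lfloor>w\<rfloor> < \<lfloor>u\<rfloor> \<and> 0 < \<lfloor>u\<rfloor>"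
proof -
  have u: "1 \<le> \<lfloor>u\<rfloor>" using assms(1) by (simp add: le_floor_iff)
  then have "1 \<le> real_of_int \<lfloor>u\<rfloor>" by simp
  moreover have "u < real_of_int \<lfloor>u\<rfloor> + 1" by simp
  ultimately have "w < real_of_int \<lfloor>u\<rfloor>" using assms(2) by linarith
  with u show ?thesis by (simp add: floor_less_iff)
qed

text \<open>
  While the loop runs, \<open>\<epsilon> / d \<ge> 1\<close> for a positive lower bound \<open>d\<close> of \<open>g\<close>, and halving a
  number that is at least \<open>1\<close> lowers its integer part.
\<close>

lemma halving_loop_terminates:
  fixes g :: "real \<Rightarrow> real"
  assumes d: "0 < d" "\<And>\<epsilon>. 0 < \<epsilon> \<Longrightarrow> d \<le> g \<epsilon>" and "0 < \<epsilon>0"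
  obtains \<epsilon> where "while_option (\<lambda>\<epsilon>. g \<epsilon> \<le> \<epsilon>) (\<lambda>\<epsilon>. g \<epsilon> / 2) \<epsilon>0 = Some \<epsilon>"
    and "0 < \<epsilon>" and "\<epsilon> < g \<epsilon>"
proof -
  let ?loop = "while_option (\<lambda>\<epsilon>. g \<epsilon> \<le> \<epsilon>) (\<lambda>\<epsilon>. g \<epsilon> / 2) \<epsilon>0"
  have pos: "0 < g \<epsilon> / 2" if "0 < \<epsilon>" for \<epsilon>
    using d that by fastforce
  have "\<exists>\<epsilon>. ?loop = Some \<epsilon>"
  proof (rule measure_while_option_Some[where P = "\<lambda>\<epsilon>. 0 < \<epsilon>"
        and f = "\<lambda>\<epsilon>. nat \<lfloor>\<epsilon> / d\<rfloor>"])
    fix \<epsilon> :: real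
    assume \<epsilon>: "0 < \<epsilon>" "g \<epsilon> \<le> \<epsilon>"
    have "1 \<le> \<epsilon> / d" using d \<epsilon> by (force simp: field_simps)
    moreover have "g \<epsilon> / 2 / d \<le> \<epsilon> / d / 2" using d(1) \<epsilon>(2) by (simp add: field_simps)
    ultimately have "\<lfloor>g \<epsilon> / 2 / d\<rfloor> < \<lfloor>\<epsilon> / d\<rfloor> \<and> 0 < \<lfloor>\<epsilon> / d\<rfloor>"
      by (rule floor_less_of_le_half)
    then show "0 < g \<epsilon> / 2 \<and> nat \<lfloor>g \<epsilon> / 2 / d\<rfloor> < nat \<lfloor>\<epsilon> / d\<rfloor>"
      using pos[OF \<epsilon>(1)] by simp
  qed fact
  then obtain \<epsilon> where \<epsilon>: "?loop = Some \<epsilon>" by blast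
  have "0 < \<epsilon>"
    by (rule while_option_rule[where P = "\<lambda>\<epsilon>. 0 < \<epsilon>", OF _ \<epsilon>]) (use pos assms in auto)
  moreover have "\<epsilon> < g \<epsilon>"
    using while_option_stop[OF \<epsilon>] by simp
  ultimately show ?thesis using that \<epsilon> by blast
qed

theorem proposition6:
  fixes A :: "real^'n^'n" and T :: real and K :: nat
    and tie :: "'n set \<Rightarrow> 'n set \<Rightarrow> 'n set \<Rightarrow> 'n"
    and S :: "real \<Rightarrow> 'n set"
  assumes "T > 0"
    and "strongly_connected (graph_of A)"
    and "C_sets A K \<noteq> {}"
    and "tie_rule tie"
    and "S = forward_greedy A T K tie \<or> S = reverse_greedy A T K tie"
    and "\<forall>\<epsilon>>0. invertible (gramian A T (S \<epsilon>))"
  shows "\<forall>\<xi>>0. \<forall>\<epsilon>0>0. \<exists>\<epsilon>>0.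
           eps_selection A T S \<xi> \<epsilon>0 = Some (\<epsilon>, S \<epsilon>) \<and>
           F_metric A T (S \<epsilon>) < (1 + \<xi>) * F_eps A T \<epsilon> (S \<epsilon>)"
proof (intro allI impI)
  fix \<xi> \<epsilon>0 :: real
  assume \<xi>: "\<xi> > 0" and \<epsilon>0: "\<epsilon>0 > 0"
  have inv: "invertible (gramian A T (S \<epsilon>))" if "\<epsilon> > 0" for \<epsilon>
    using assms(6) that by blast
  define L where "L = (\<lambda>\<epsilon>. lambda1 A T (S \<epsilon>)) ` {0<..}"
  define c where "c = Min L"
  have "finite L"
    by (rule finite_subset[of _ "range (lambda1 A T)"]) (auto simp: L_def)
  moreover have "L \<noteq> {}" by (auto simp: L_def)
  moreover have "0 < l" if "l \<in> L" for l
  proof -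
    obtain \<epsilon> where "\<epsilon> > 0" and l: "l = lambda1 A T (S \<epsilon>)"
      using \<open>l \<in> L\<close> unfolding L_def by blast
    note inv = inv[OF \<open>\<epsilon> > 0\<close>]
    show ?thesis
      unfolding l lambda1_def
      by (rule Min_eigenvalue_pos[OF invertible_gramian_semidefinite[OF inv] inv])
  qed
  ultimately have "0 < c" unfolding c_def by simp
  moreover have "c \<le> lambda1 A T (S \<epsilon>)" if "\<epsilon> > 0" for \<epsilon>
    using \<open>finite L\<close> that by (auto simp: c_def L_def intro!: Min_le)
  ultimately have "0 < \<xi> * c" and "\<And>\<epsilon>. \<epsilon> > 0 \<Longrightarrow> \<xi> * c \<le> \<xi> * lambda1 A T (S \<epsilon>)"
    using \<xi> by simp_all
  from halving_loop_terminates[where g = "\<lambda>\<epsilon>. \<xi> * lambda1 A T (S \<epsilon>)", OF this \<epsilon>0]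
  obtain \<epsilon> where
    loop: "while_option (\<lambda>\<epsilon>. \<xi> * lambda1 A T (S \<epsilon>) \<le> \<epsilon>) (\<lambda>\<epsilon>. \<xi> * lambda1 A T (S \<epsilon>) / 2) \<epsilon>0
        = Some \<epsilon>"
    and \<epsilon>: "0 < \<epsilon>" "\<epsilon> < \<xi> * lambda1 A T (S \<epsilon>)" .
  have "eps_selection A T S \<xi> \<epsilon>0 = Some (\<epsilon>, S \<epsilon>)"
    using loop by (simp add: eps_selection_def)
  moreover have "F_metric A T (S \<epsilon>) < (1 + \<xi>) * F_eps A T \<epsilon> (S \<epsilon>)"
    unfolding F_metric_def F_eps_def
    by (rule trace_inverse_regularized[OF invertible_gramian_semidefinite[OF inv[OF \<epsilon>(1)]]
          inv[OF \<epsilon>(1)] \<epsilon>[unfolded lambda1_def] \<xi>])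
  ultimately show "\<exists>\<epsilon>>0. eps_selection A T S \<xi> \<epsilon>0 = Some (\<epsilon>, S \<epsilon>) \<and>
      F_metric A T (S \<epsilon>) < (1 + \<xi>) * F_eps A T \<epsilon> (S \<epsilon>)"
    using \<epsilon>(1) by blast
qed

end
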